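(* Let $\alpha_1,\ldots,\alpha_r$ be positive real numbers with $\sum_{i=1}^r\alpha_i=1$ that are linearly independent over $\mathbb{Q}$, and let $\pi$ be the permutation of $\{1,\ldots,r\}$ given by $\pi(k)=r+1-k$ for all $k$. Let $T:[0,1)\to[0,1)$ be the $r$-interval exchange transformation associated with $\alpha_1,\ldots,\alpha_r$ and $\pi$, let $x_0\in[0,1)$, and let $u=(u_n)_{n\in\mathbb{Z}}$ be the infinite word over $\{1,\ldots,r\}$ coding the orbit of $x_0$ under $T$. Then the palindromic complexity $\mathcal{P}$ of $u$ satisfies, for $n\in\mathbb{N}$, $$\mathcal{P}(n)=\begin{cases}1 & \text{for each } n \text{ even},\\ r & \text{for each } n \text{ odd}.\end{cases}$$
   Context: $\mathbb{N}=\{0,1,2,\dots\}$. Put $I_k=\bigl[\sum_{i=1}^{k-1}\alpha_i,\ \sum_{i=1}^{k}\alpha_i\bigr)$ for $k=1,\ldots,r$; these intervals partition $[0,1)$. The interval exchange transformation associated with $\alpha_1,\ldots,\alpha_r$ and a permutation $\pi$ is the bijection $T:[0,1)\to[0,1)$ given by $$T(x)=x+\sum_{j<\pi(k)}\alpha_{\pi^{-1}(j)}-\sum_{j<k}\alpha_j\quad\text{for } x\in I_k.$$ For the permutation $\pi(k)=r+1-k$ this reads $T(x)=x+\sum_{j>k}\alpha_j-\sum_{j<k}\alpha_j$ for $x\in I_k$. The bidirectional infinite word $(u_n)_{n\in\mathbb{Z}}$ coding the orbit $(T^n(x_0))_{n\in\mathbb{Z}}$ is defined by $u_n=k\iff T^n(x_0)\in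 I_k$. A factor of length $n$ of $u$ is a word of the form $u_iu_{i+1}\cdots u_{i+n-1}$ with $i\in\mathbb{Z}$ (the empty word if $n=0$). A word $w_1\cdots w_n$ is a palindrome if $w_1\cdots w_n=w_n\cdots w_1$ (the empty word is a palindrome). The palindromic complexity $\mathcal{P}(n)$ of $u$ is the number of distinct factors of $u$ of length $n$ that are palindromes. *)

theory Defs
  imports "HOL-Analysis.Analysis" "HOL-Combinatorics.Permutations"
begin

text \<open>Lengths and permutation are indexed by \<open>{1..r}\<close>; the values of \<open>\<alpha>\<close> outside this
  set are never used.\<close>

definition iet_interval :: "(nat \<Rightarrow> real) \<Rightarrow> nat \<Rightarrow> real set" where
  "iet_interval \<alpha> k = {(\<Sum>i=1..k-1. \<alpha> i) ..< (\<Sum>i=1..k. \<alpha> i)}"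

text \<open>For positive lengths of total 1 the intervals partition \<open>[0,1)\<close>, so the index is well
  defined at every \<open>x \<in> [0,1)\<close>; it is unspecified elsewhere.\<close>

definition iet_index :: "nat \<Rightarrow> (nat \<Rightarrow> real) \<Rightarrow> real \<Rightarrow> nat" where
  "iet_index r \<alpha> x = (THE k. k \<in> {1..r} \<and> x \<in> iet_interval \<alpha> k)"

definition iet :: "nat \<Rightarrow> (nat \<Rightarrow> real) \<Rightarrow> (nat \<Rightarrow> nat) \<Rightarrow> real \<Rightarrow> real" where
  "iet r \<alpha> \<pi> x =
     (let k = iet_index r \<alpha> x
      in x + (\<Sum>j\<in>{1..<\<pi> k}. \<alpha> (inv \<pi> j)) - (\<Sum>j\<in>{1..<k}. \<alpha> j))"

text \<open>Integer iterates of a bijection \<open>f\<close> of \<open>S\<close>: the inverse is taken on \<open>S\<close>, so the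
  values of \<open>f\<close> outside \<open>S\<close> play no role.\<close>

definition int_iterate :: "'a set \<Rightarrow> ('a \<Rightarrow> 'a) \<Rightarrow> int \<Rightarrow> 'a \<Rightarrow> 'a" where
  "int_iterate S f n =
     (if n \<ge> 0 then f ^^ nat n else inv_into S f ^^ nat (- n))"

definition iet_word :: "nat \<Rightarrow> (nat \<Rightarrow> real) \<Rightarrow> (nat \<Rightarrow> nat) \<Rightarrow> real \<Rightarrow> int \<Rightarrow> nat" where
  "iet_word r \<alpha> \<pi> x0 n = iet_index r \<alpha> (int_iterate {0..<1} (iet r \<alpha> \<pi>) n x0)"

definition factors :: "(int \<Rightarrow> 'a) \<Rightarrow> nat \<Rightarrow> 'a list set" where
  "factors u n = {map (\<lambda>j. u (i + int j)) [0..<n] | i. True}"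

definition palindrome :: "'a list \<Rightarrow> bool" where
  "palindrome w \<longleftrightarrow> rev w = w"

definition palindromic_complexity :: "(int \<Rightarrow> 'a) \<Rightarrow> nat \<Rightarrow> nat" where
  "palindromic_complexity u n = card {w \<in> factors u n. palindrome w}"

end

theory Submission
  imports Defs
begin

text \<open>
The reason for the formula is that \<open>T\<close> is a product of two reflections. Let \<open>S x = 1 - x\<close> and let
\<open>\<rho>\<close> reflect every interval \<open>I\<^sub>k\<close> in its own midpoint; up to interval endpoints, \<open>T = S \<circ> \<rho>\<close>, so
\<open>S \<circ> T \<circ> S\<close> is the inverse of \<open>T\<close>. The points coded by a word \<open>w\<close> of length \<open>n\<close> form an interval on which \<open>T\<^sup>n\<close>
is a translation, and \<open>S \<circ> T\<^sup>n\<close> reflects this interval onto the one that belongs to the reversed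
word. If \<open>w\<close> is a palindrome, the midpoint \<open>m\<close> of its interval therefore satisfies \<open>T\<^sup>n m = 1 - m\<close>,
and at most one point of the interval does. So the palindromes of length \<open>n\<close> that code some point are
in bijection with the solutions of \<open>T\<^sup>n m = 1 - m\<close> whose code is a palindrome
(\<open>palindrome_code_of_centre\<close>, \<open>centre_of_palindrome_code\<close>).

The solutions are found in the middle of the orbit segment (\<open>centreI\<close>, \<open>centre_reflected\<close>): for
\<open>n = 2 k\<close> they are given by \<open>T\<^sup>k m = 1/2\<close>, and for \<open>n = 2 k + 1\<close> by the \<open>r\<close> equations
\<open>T\<^sup>k m = midpoint of I\<^sub>j\<close>. As \<open>T\<close> is bijective, this gives \<open>1\<close> and \<open>r\<close> points. Their orbits never meet an
interval endpoint, where the reflection argument breaks down: endpoints and displacements are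
integer combinations of the lengths, whereas \<open>1/2\<close> and the midpoints are half-integer ones
(\<open>centre_avoids_breaks\<close>).

It remains to see that each of these palindromes occurs in the given orbit, for which the orbit must
be dense when \<open>r \<ge> 2\<close> (\<open>invariant_dense\<close>). In the displacement of an orbit segment, written as an integer
combination of the lengths, the difference of the last and the first coefficient grows with every
step. This shows that there are no periodic points and that no break is carried to a positive break in one or more steps
(\<open>aperiodic\<close>, \<open>break_to_break\<close>). If an invariant set is not dense, some gap in it
has a positive left end \<open>a\<close>. Either the forward or the backward orbit of \<open>a\<close> avoids all discontinuities, so it
consists of left ends of infinitely many disjoint gaps, whose lengths are eventually bounded below
(\<open>no_wandering_left_end\<close>). That is impossible.
\<close>

section \<open>Two-sided orbits\<close>

lemma int_iterate_0 [simp]: "int_iterate S f 0 x = x"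
  by (simp add: int_iterate_def)

lemma int_iterate_in:
  assumes "bij_betw f S S" "x \<in> S"
  shows "int_iterate S f i x \<in> S"
proof -
  have 1: "(f ^^ n) x \<in> S" for n
    using assms by (induction n) (auto simp: bij_betw_def)
  have 2: "(inv_into S f ^^ n) x \<in> S" for n
    using assms by (induction n) (auto simp: bij_betw_def intro!: inv_into_into)
  show ?thesis using 1 2 by (simp add: int_iterate_def)
qed

lemma int_iterate_Suc:
  assumes "bij_betw f S S" "x \<in> S"
  shows "int_iterate S f (i + 1) x = f (int_iterate S f i x)"
proof (cases "i \<ge> 0")
  case True
  then have "nat (i + 1) = Suc (nat i)" by simp
  with True show ?thesis by (simp add: int_iterate_def)
next
  case False
  then have n: "nat (- i) = Suc (nat (- (i + 1)))" by simp
  have "int_iterate S f i x = inv_into S f ((inv_into S f ^^ nat (- (i + 1))) x)"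
    using False n by (simp add: int_iterate_def)
  also have "(inv_into S f ^^ nat (- (i + 1))) x = int_iterate S f (i + 1) x"
    using False by (cases "i = -1") (auto simp: int_iterate_def)
  finally show ?thesis
    using int_iterate_in[OF assms, of "i + 1"] assms(1)
    by (simp add: f_inv_into_f bij_betw_def)
qed

lemma int_iterate_add:
  assumes "bij_betw f S S" "x \<in> S"
  shows "int_iterate S f (i + int j) x = (f ^^ j) (int_iterate S f i x)"
proof (induction j)
  case (Suc j)
  have "i + int (Suc j) = (i + int j) + 1" by simp
  then show ?case using int_iterate_Suc[OF assms, of "i + int j"] Suc by (simp only: funpow.simps comp_def)
qed simp

lemma orbit_invariant:
  assumes f: "bij_betw f S S" and x: "x \<in> S" and y: "y \<in> S"
  shows "f y \<in> range (\<lambda>i. int_iterate S f i x) \<longleftrightarrow> y \<in> range (\<lambda>i. int_iterate S f i x)"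
proof
  assume "f y \<in> range (\<lambda>i. int_iterate S f i x)"
  then obtain i where i: "f y = int_iterate S f i x" by auto
  also have "\<dots> = f (int_iterate S f (i - 1) x)"
    using int_iterate_Suc[OF f x, of "i - 1"] by simp
  finally have "y = int_iterate S f (i - 1) x"
    using f y int_iterate_in[OF f x] by (auto simp: bij_betw_def dest: inj_onD)
  then show "y \<in> range (\<lambda>i. int_iterate S f i x)" by auto
next
  assume "y \<in> range (\<lambda>i. int_iterate S f i x)"
  then obtain i where "y = int_iterate S f i x" by auto
  then have "f y = int_iterate S f (i + 1) x" using int_iterate_Suc[OF f x] by simp
  then show "f y \<in> range (\<lambda>i. int_iterate S f i x)" by auto
qed

section \<open>Piecewise translations and the gaps of invariant sets\<close>

text \<open>The breaks \<open>D\<close> are the left endpoints of the pieces, so \<open>0\<close> is forced to be one of them.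
Asking each point for a break on its left, rather than listing the pieces, makes the notion
visibly stable under inversion.\<close>

definition piecewise_translation :: "(real \<Rightarrow> real) \<Rightarrow> real set \<Rightarrow> bool" where
  "piecewise_translation F D \<longleftrightarrow>
     bij_betw F {0..<1} {0..<1} \<and> finite D \<and> D \<subseteq> {0..<1} \<and>
     (\<forall>x\<in>{0..<1}. \<exists>d\<in>D. d \<le> x \<and> (\<forall>y\<in>{d..x}. F y - y = F x - x))"

lemma
  assumes "piecewise_translation F D"
  shows piecewise_translation_bij: "bij_betw F {0..<1} {0..<1}"
    and piecewise_translation_finite: "finite D"
    and piecewise_translation_subset: "D \<subseteq> {0..<1}"
  using assms unfolding piecewise_translation_def by blast+

lemma piecewise_translation_left_break:
  assumes "piecewise_translation F D" "x \<in> {0..<1}"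
  obtains d where "d \<in> D" "d \<le> x" "\<And>y. y \<in> {d..x} \<Longrightarrow> F y - y = F x - x"
proof -
  have "\<exists>d\<in>D. d \<le> x \<and> (\<forall>y\<in>{d..x}. F y - y = F x - x)"
    using assms unfolding piecewise_translation_def by simp
  then show thesis using that by blast
qed

lemma piecewise_translationD:
  assumes "piecewise_translation F D" "{a<..<b} \<inter> D = {}" "0 \<le> a" "b \<le> 1" "x \<in> {a..<b}"
  shows "F x - x = F a - a"
proof -
  have "x \<in> {0..<1}" using assms(3-5) by auto
  then obtain d where d: "d \<in> D" "d \<le> x" "\<And>y. y \<in> {d..x} \<Longrightarrow> F y - y = F x - x"
    using piecewise_translation_left_break[OF assms(1)] by blast
  have "d \<notin> {a<..<b}" using d(1) assms(2) by blast
  then have "d \<le> a" using d(2) assms(5) by auto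
  then show ?thesis using d(3)[of a] assms(5) by simp
qed

text \<open>A piece \<open>[d, x]\<close> of \<open>F\<close> is carried rigidly to \<open>[F d, F x]\<close>, which is then a piece of the inverse.
The purpose is to run every argument about forward orbits also backwards in time.\<close>

lemma piecewise_translation_inv:
  assumes F: "piecewise_translation F D"
  shows "piecewise_translation (inv_into {0..<1} F) (F ` D)"
  unfolding piecewise_translation_def
proof (intro conjI ballI)
  let ?G = "inv_into {0..<1} F"
  have bij: "bij_betw F {0..<1} {0..<1}" and D: "D \<subseteq> {0..<1}" "finite D"
    using piecewise_translation_bij[OF F] piecewise_translation_subset[OF F]
      piecewise_translation_finite[OF F] by auto
  show "bij_betw ?G {0..<1} {0..<1}" using bij by (rule bij_betw_inv_into)
  show "finite (F ` D)" using D by simp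
  show "F ` D \<subseteq> {0..<1}" using D bij by (auto simp: bij_betw_def)
  fix x :: real assume x: "x \<in> {0..<1}"
  define z where "z = ?G x"
  have z: "z \<in> {0..<1}" "F z = x"
    using bij x inv_into_into[of x F "{0..<1}"] by (simp_all add: z_def bij_betw_def f_inv_into_f)
  obtain d where d: "d \<in> D" "d \<le> z" "\<And>y. y \<in> {d..z} \<Longrightarrow> F y - y = F z - z"
    using piecewise_translation_left_break[OF F z(1)] by blast
  have "F d - d = F z - z" using d(3)[of d] d(2) by simp
  then have Fd: "F d = d + x - z" using z by simp
  show "\<exists>e\<in>F ` D. e \<le> x \<and> (\<forall>y\<in>{e..x}. ?G y - y = ?G x - x)"
  proof (intro bexI conjI ballI)
    show "F d \<in> F ` D" using d by simp
    show "F d \<le> x" using Fd d by simp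
    fix y assume y: "y \<in> {F d..x}"
    then have "y - x + z \<in> {d..z}" using Fd by auto
    then have "F (y - x + z) = y" using d(3)[of "y - x + z"] z(2) by simp
    moreover have "y - x + z \<in> {0..<1}" using \<open>y - x + z \<in> {d..z}\<close> z D d(1) by force
    ultimately have "?G y = y - x + z" using bij by (metis bij_betw_def inv_into_f_f)
    then show "?G y - y = ?G x - x" by (simp add: z_def)
  qed
qed

text \<open>The value \<open>0\<close> is excluded because there is no left neighbourhood of \<open>0\<close> in \<open>[0,1)\<close> that could be
transported along with the point.\<close>

definition left_end :: "real set \<Rightarrow> real \<Rightarrow> bool" where
  "left_end V a \<longleftrightarrow> 0 < a \<and> a < 1 \<and>
     (\<exists>e>0. {a<..<a + e} \<inter> V = {}) \<and> (\<forall>e>0. {a - e<..a} \<inter> V \<noteq> {})"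

text \<open>The supremum of the part of \<open>V\<close> to the left of the gap is a left end; the point \<open>v\<close> keeps this
supremum away from \<open>0\<close>.\<close>

lemma left_end_of_gap:
  assumes "{c<..<d} \<inter> V = {}" "c < d" "d \<le> 1" "v \<in> V" "0 < v" "v \<le> c"
  obtains a where "left_end V a"
proof -
  define a where "a = Sup (V \<inter> {..c})"
  have bdd: "bdd_above (V \<inter> {..c})" by auto
  have ne: "V \<inter> {..c} \<noteq> {}" using assms by auto
  have va: "v \<le> a" unfolding a_def using assms bdd by (intro cSup_upper) auto
  have ac: "a \<le> c" unfolding a_def using ne by (intro cSup_least) auto
  have "{a<..<a + (d - a)} \<inter> V = {}"
  proof (rule ccontr)
    assume "{a<..<a + (d - a)} \<inter> V \<noteq> {}"
    then obtain y where y: "y \<in> V" "a < y" "y < d" by auto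
    then have "\<not> y \<le> c" using cSup_upper[OF _ bdd, of y] by (auto simp: a_def)
    then show False using y assms(1) by (auto simp: disjoint_iff)
  qed
  moreover have "{a - e<..a} \<inter> V \<noteq> {}" if "e > 0" for e
  proof -
    obtain y where "y \<in> V \<inter> {..c}" "a - e < y"
      using less_cSup_iff[OF ne bdd, of "a - e"] \<open>e > 0\<close> unfolding a_def by auto
    moreover from this have "y \<le> a" using cSup_upper[OF _ bdd, of y] by (auto simp: a_def)
    ultimately show ?thesis by auto
  qed
  moreover have "0 < a" "a < 1" "d - a > 0" using va ac assms by auto
  ultimately have "left_end V a" unfolding left_end_def by blast
  then show thesis by (rule that)
qed

lemma finite_avoid_left:
  fixes a :: real
  assumes "finite D"
  obtains e where "e > 0" "{a - e<..<a} \<inter> D = {}"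
proof -
  let ?D = "{d \<in> D. d < a}"
  show thesis
  proof (cases "?D = {}")
    case True
    then show thesis by (intro that[of 1]) auto
  next
    case False
    have "Max ?D \<in> ?D" using assms False by (intro Max_in) auto
    moreover have "d \<le> Max ?D" if "d \<in> D" "d < a" for d using assms that by simp
    ultimately show thesis by (intro that[of "a - Max ?D"]) (auto simp: disjoint_iff not_le[symmetric])
  qed
qed

lemma finite_avoid_right:
  fixes a :: real
  assumes "finite D"
  obtains e where "e > 0" "{a<..<a + e} \<inter> D = {}"
proof -
  obtain e where "e > 0" "{- a - e<..<- a} \<inter> uminus ` D = {}"
    using finite_avoid_left[of "uminus ` D" "- a"] assms by auto
  then have "{a<..<a + e} \<inter> D = {}" by (force simp: image_iff)
  with \<open>e > 0\<close> show thesis by (rule that)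
qed

lemma gap_image:
  assumes F: "piecewise_translation F D" and a: "0 \<le> a" "a + e \<le> 1"
    and inv: "\<And>x. x \<in> {0..<1} \<Longrightarrow> F x \<in> V \<longleftrightarrow> x \<in> V"
    and D: "{a<..<a + e} \<inter> D = {}" and gap: "{a<..<a + e} \<inter> V = {}"
  shows "{F a<..<F a + e} \<inter> V = {}"
proof (rule ccontr)
  assume "{F a<..<F a + e} \<inter> V \<noteq> {}"
  then obtain y where y: "y \<in> V" "F a < y" "y < F a + e" by auto
  define x where "x = y - F a + a"
  have x: "x \<in> {a<..<a + e}" using y by (auto simp: x_def)
  then have "F x - x = F a - a"
    using piecewise_translationD[OF F D, of x] a by auto
  then have "F x = y" by (simp add: x_def)
  then have "x \<in> V" using inv[of x] y x a by auto
  then show False using x gap by auto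
qed

text \<open>Away from the breaks, \<open>F\<close> is a translation on both sides of \<open>a\<close>, so the picture of an invariant
set near \<open>a\<close> is copied to \<open>F a\<close>.\<close>

lemma left_end_image:
  assumes F: "piecewise_translation F D"
    and inv: "\<And>x. x \<in> {0..<1} \<Longrightarrow> F x \<in> V \<longleftrightarrow> x \<in> V"
    and a: "left_end V a" "a \<notin> D" "F a \<noteq> 0"
  shows "left_end V (F a)"
proof -
  have a01: "0 < a" "a < 1" and near: "\<And>e. e > 0 \<Longrightarrow> {a - e<..a} \<inter> V \<noteq> {}"
    using a(1) unfolding left_end_def by blast+
  have fin: "finite D" using F by (rule piecewise_translation_finite)
  have Fa: "F a \<in> {0..<1}" using bij_betwE[OF piecewise_translation_bij[OF F]] a01 by simp
  obtain e where e: "e > 0" "{a<..<a + e} \<inter> V = {}" using a(1) unfolding left_end_def by blast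
  obtain e1 where e1: "e1 > 0" "{a - e1<..<a} \<inter> D = {}" by (rule finite_avoid_left[OF fin])
  obtain e2 where e2: "e2 > 0" "{a<..<a + e2} \<inter> D = {}" by (rule finite_avoid_right[OF fin])
  define e3 where "e3 = min e (min e2 (1 - a))"
  have e3: "e3 > 0" "a + e3 \<le> 1" "{a<..<a + e3} \<inter> D = {}" "{a<..<a + e3} \<inter> V = {}"
    using e e2 a01 by (auto simp: e3_def disjoint_iff)
  have "{F a<..<F a + e3} \<inter> V = {}"
    using gap_image[OF F _ e3(2) inv e3(3,4)] a01 by simp
  moreover have "{F a - s<..F a} \<inter> V \<noteq> {}" if s: "s > 0" for s
  proof -
    define t where "t = min s (min e1 a)"
    have t: "t > 0" using s e1 a01 by (simp add: t_def)
    then obtain y where y: "y \<in> V" "a - t < y" "y \<le> a" using near[of t] by auto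
    have ya: "F a - a = F y - y"
    proof (rule piecewise_translationD[OF F])
      show "{y<..<a + e3} \<inter> D = {}"
      proof (rule ccontr)
        assume "{y<..<a + e3} \<inter> D \<noteq> {}"
        then obtain d where d: "d \<in> D" "y < d" "d < a + e3" by auto
        then have "d \<noteq> a" using a by auto
        then show False using d e1(2) e3(3) y by (cases "d < a") (auto simp: t_def disjoint_iff)
      qed
    qed (use y e3 t in \<open>auto simp: t_def\<close>)
    have "y \<in> {0..<1}" using y a01 by (auto simp: t_def)
    then have "F y \<in> V" using inv[of y] y(1) by simp
    moreover have "F y \<in> {F a - s<..F a}" using ya y by (auto simp: t_def)
    ultimately show ?thesis by blast
  qed
  moreover have "0 < F a" "F a < 1" using Fa a(3) by auto
  ultimately show ?thesis using e3(1) unfolding left_end_def by blast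
qed

text \<open>If the half orbit of \<open>a\<close> never meets a break, all its points are left ends of pairwise disjoint
gaps of \<open>V\<close>. A break can lie inside at most one of these gaps, so from some time on the gaps are
moved rigidly and do not get shorter. Infinitely many disjoint intervals of a fixed length do not
fit into \<open>[0,1)\<close>.\<close>

lemma no_wandering_left_end:
  assumes F: "piecewise_translation F D"
    and inv: "\<And>x. x \<in> {0..<1} \<Longrightarrow> F x \<in> V \<longleftrightarrow> x \<in> V"
    and a: "left_end V a"
    and avoid: "\<And>n. (F ^^ n) a \<notin> D"
    and inj: "inj (\<lambda>n. (F ^^ n) a)"
  shows False
proof -
  define A where "A n = (F ^^ n) a" for n
  have D: "finite D" and "0 \<in> D"
  proof -
    show "finite D" using F by (rule piecewise_translation_finite)
    have "(0::real) \<in> {0..<1}" by simp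
    then obtain d where "d \<in> D" "d \<le> 0"
      using piecewise_translation_left_break[OF F] by blast
    moreover have "d \<in> {0..<1}" using \<open>d \<in> D\<close> piecewise_translation_subset[OF F] by blast
    ultimately show "0 \<in> D" by (cases "d = 0") auto
  qed
  have A_Suc: "A (Suc n) = F (A n)" for n by (simp add: A_def)
  have A_D: "A n \<notin> D" for n using avoid by (simp add: A_def)
  have L: "left_end V (A n)" for n
  proof (induction n)
    case 0
    show ?case using a by (simp add: A_def)
  next
    case (Suc n)
    have "F (A n) \<noteq> 0" using A_D[of "Suc n"] \<open>0 \<in> D\<close> by (auto simp: A_Suc)
    then show ?case using left_end_image[OF F inv Suc A_D] by (simp add: A_Suc)
  qed
  have between: "{A m<..A n} \<inter> V \<noteq> {}" if "A m < A n" for m n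
  proof -
    have "{A n - (A n - A m)<..A n} \<inter> V \<noteq> {}"
      using L[of n] that unfolding left_end_def by (elim conjE allE[of _ "A n - A m"] impE) simp_all
    then show ?thesis by simp
  qed
  (* The times at which d lies inside, or at the right end of, the gap that starts at A n. *)
  define B where "B d = {n. A n < d \<and> {A n<..<d} \<inter> V = {}}" for d
  have fin_B: "finite (B d)" for d
  proof -
    have "m = n" if "m \<in> B d" "n \<in> B d" for m n
    proof (rule ccontr)
      assume "m \<noteq> n"
      then have "A m \<noteq> A n" using inj by (auto simp: A_def inj_def)
      then show False using that between[of m n] between[of n m]
        by (fastforce simp: B_def neq_iff)
    qed
    then have "B d \<subseteq> {SOME n. n \<in> B d}" by (metis singletonI someI_ex subsetI)
    then show ?thesis by (rule finite_subset) simp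
  qed
  then have "finite (\<Union>d\<in>D. B d)" using D by blast
  then obtain N where N: "\<And>n. n \<in> (\<Union>d\<in>D. B d) \<Longrightarrow> n < N"
    unfolding finite_nat_set_iff_bounded by metis
  obtain e where e: "e > 0" "{A N<..<A N + e} \<inter> V = {}"
    using L[of N] unfolding left_end_def by blast
  define s where "s = min e (1 - A N)"
  have A01: "A n \<in> {0<..<1}" for n using L[of n] unfolding left_end_def by simp
  have s: "s > 0" using e A01[of N] by (auto simp: s_def)
  have gap: "A (N + n) + s \<le> 1 \<and> {A (N + n)<..<A (N + n) + s} \<inter> V = {}" for n
  proof (induction n)
    case 0
    show ?case using e by (auto simp: s_def disjoint_iff)
  next
    case (Suc n)
    let ?x = "A (N + n)"
    have nd: "{?x<..<?x + s} \<inter> D = {}"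
    proof (rule ccontr)
      assume "{?x<..<?x + s} \<inter> D \<noteq> {}"
      then obtain d where "d \<in> D" "d \<in> {?x<..<?x + s}" by blast
      moreover have "{?x<..<d} \<subseteq> {?x<..<?x + s}" using calculation by auto
      ultimately have "N + n \<in> B d" using Suc unfolding B_def by auto
      then show False using N[of "N + n"] \<open>d \<in> D\<close> by auto
    qed
    have x: "0 \<le> ?x" "?x < 1" using A01[of "N + n"] by auto
    have "{F ?x<..<F ?x + s} \<inter> V = {}"
      using gap_image[OF F x(1) _ inv nd] Suc by simp
    moreover have "F ?x + s \<le> 1"
    proof (rule field_le_epsilon)
      fix t :: real assume "t > 0"
      define y where "y = ?x + s - min t s"
      have y: "y \<in> {?x..<?x + s}" using s \<open>t > 0\<close> by (auto simp: y_def)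
      then have "F y - y = F ?x - ?x"
        using piecewise_translationD[OF F nd x(1) _ y] Suc by simp
      moreover have "F y < 1"
      proof -
        have "y \<in> {0..<1}" using y Suc x by auto
        then show ?thesis using bij_betwE[OF piecewise_translation_bij[OF F]] by simp
      qed
      ultimately show "F ?x + s \<le> 1 + t" by (auto simp: y_def)
    qed
    ultimately show ?case by (simp add: A_Suc)
  qed
  have sep: "A (N + m) + s \<le> A (N + n)" if "A (N + m) < A (N + n)" for m n
    using between[OF that] gap[of m] by force
  (* Separated points fall into different cells of a grid of mesh s. *)
  define q where "q n = \<lfloor>A (N + n) / s\<rfloor>" for n
  have "inj q"
  proof (rule injI, rule ccontr)
    have *: "q m < q n" if "A (N + m) < A (N + n)" for m n
    proof -
      have "A (N + m) / s + 1 \<le> A (N + n) / s" using divide_right_mono[OF sep[OF that], of s] s by (simp add: add_divide_distrib)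
      then show ?thesis unfolding q_def by linarith
    qed
    fix m n assume "q m = q n" "m \<noteq> n"
    then have "A (N + m) \<noteq> A (N + n)" using injD[OF inj, of "N + m" "N + n"] by (auto simp: A_def)
    then show False using *[of m n] *[of n m] \<open>q m = q n\<close> by linarith
  qed
  moreover have "range q \<subseteq> {0..\<lfloor>1 / s\<rfloor>}"
  proof
    fix k assume "k \<in> range q"
    then obtain n where n: "k = q n" by auto
    have "0 \<le> A (N + n) / s" "A (N + n) / s \<le> 1 / s"
      using A01[of "N + n"] s by (auto simp: field_simps)
    then show "k \<in> {0..\<lfloor>1 / s\<rfloor>}" by (auto simp: n q_def floor_mono)
  qed
  then have "finite (range q)" by (rule finite_subset) simp
  ultimately show False using finite_imageD[of q UNIV] by simp
qed

section \<open>Sums over palindromes\<close>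

lemma palindrome_nth:
  assumes "palindrome w" "j < length w"
  shows "w ! (length w - 1 - j) = w ! j"
  using assms rev_nth[of j w] by (simp add: palindrome_def)

text \<open>The last \<open>j\<close> letters of a palindrome are its first \<open>j\<close> letters, so they have the same sum.\<close>

lemma palindrome_sum:
  fixes f :: "'a \<Rightarrow> 'b::ab_group_add"
  assumes pal: "palindrome w" and "j \<le> length w"
  shows "(\<Sum>i<length w - j. f (w ! i)) = (\<Sum>i<length w. f (w ! i)) - (\<Sum>i<j. f (w ! i))"
  using assms(2)
proof (induction j)
  case (Suc j)
  have "length w - j = Suc (length w - 1 - j)" using Suc.prems by simp
  then have "(\<Sum>i<length w - j. f (w ! i)) = (\<Sum>i<length w - Suc j. f (w ! i)) + f (w ! j)"
    using palindrome_nth[OF pal, of j] Suc.prems by simp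
  then show ?case using Suc by (simp add: algebra_simps)
qed simp

section \<open>Symmetric interval exchanges\<close>

locale symmetric_iet =
  fixes r :: nat and \<alpha> :: "nat \<Rightarrow> real" and \<pi> :: "nat \<Rightarrow> nat"
  assumes lengths_pos: "\<And>i. i \<in> {1..r} \<Longrightarrow> \<alpha> i > 0"
    and total_length: "(\<Sum>i=1..r. \<alpha> i) = 1"
    and lengths_inj: "inj_on \<alpha> {1..r}"
    and lengths_indep: "module.independent (\<lambda>(q::rat) (x::real). of_rat q * x) (\<alpha> ` {1..r})"
    and perm: "\<pi> permutes {1..r}"
    and reversal: "\<And>k. k \<in> {1..r} \<Longrightarrow> \<pi> k = r + 1 - k"
begin

definition b :: "nat \<Rightarrow> real" where "b k = (\<Sum>i=1..k. \<alpha> i)"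

definition shift :: "nat \<Rightarrow> real" where "shift k = 1 - b k - b (k - 1)"

definition midpoint :: "nat \<Rightarrow> real" where "midpoint k = (b (k - 1) + b k) / 2"

abbreviation "breaks \<equiv> b ` {..<r}"
abbreviation "idx \<equiv> iet_index r \<alpha>"
abbreviation "T \<equiv> iet r \<alpha> \<pi>"

definition code :: "nat \<Rightarrow> real \<Rightarrow> nat list" where
  "code n x = map (\<lambda>j. idx ((T ^^ j) x)) [0..<n]"

lemma b_0 [simp]: "b 0 = 0" and b_r [simp]: "b r = 1"
  using total_length by (simp_all add: b_def)

lemma b_Suc: "b (Suc k) = b k + \<alpha> (Suc k)"
  by (simp add: b_def)

lemma r_pos: "r \<ge> 1"
  using total_length by (cases r) auto

lemma b_strict: "j < k \<Longrightarrow> k \<le> r \<Longrightarrow> b j < b k"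
proof (induction k)
  case (Suc k)
  then have "b k < b (Suc k)" using lengths_pos[of "Suc k"] by (simp add: b_Suc)
  then show ?case using Suc by (cases "j = k") auto
qed simp

lemma b_mono: "j \<le> k \<Longrightarrow> k \<le> r \<Longrightarrow> b j \<le> b k"
  using b_strict[of j k] by (cases "j = k") auto

lemma b_nonneg: "k \<le> r \<Longrightarrow> 0 \<le> b k" and b_le_1: "k \<le> r \<Longrightarrow> b k \<le> 1"
  using b_mono[of 0 k] b_mono[of k r] by auto

lemma breaks_subset: "breaks \<subseteq> {0..<1}"
  using b_nonneg b_strict[of _ r] by auto

lemma interval_subset:
  assumes "k \<in> {1..r}" "b (k - 1) \<le> x" "x < b k"
  shows "x \<in> {0..<1}"
proof -
  have "k - 1 \<le> r" "k \<le> r" using assms(1) by auto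
  then show ?thesis using assms(2,3) b_nonneg[of "k - 1"] b_le_1[of k] by simp
qed

lemma interval_unique:
  assumes "k \<in> {1..r}" "l \<in> {1..r}" "b (k - 1) \<le> x" "x < b k" "b (l - 1) \<le> x" "x < b l"
  shows "k = l"
proof -
  have "\<not> k < l" using assms b_mono[of k "l - 1"] by fastforce
  moreover have "\<not> l < k" using assms b_mono[of l "k - 1"] by fastforce
  ultimately show ?thesis by simp
qed

lemma idx_eqI:
  assumes "k \<in> {1..r}" "b (k - 1) \<le> x" "x < b k"
  shows "idx x = k"
  unfolding iet_index_def
proof (rule the_equality)
  show "k \<in> {1..r} \<and> x \<in> iet_interval \<alpha> k"
    using assms by (simp add: iet_interval_def b_def)
  fix l assume "l \<in> {1..r} \<and> x \<in> iet_interval \<alpha> l"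
  then have "l \<in> {1..r}" "b (l - 1) \<le> x" "x < b l" by (simp_all add: iet_interval_def b_def)
  then show "l = k" using interval_unique[OF _ assms(1) _ _ assms(2,3)] by blast
qed

lemma interval_exists:
  assumes "x \<in> {0..<1}"
  obtains k where "k \<in> {1..r}" "b (k - 1) \<le> x" "x < b k"
proof -
  define k where "k = (LEAST k. x < b k)"
  have x: "x < b r" using assms by simp
  have 1: "x < b k" unfolding k_def by (rule LeastI[of "\<lambda>k. x < b k", OF x])
  have 2: "k \<le> r" unfolding k_def by (rule Least_le[of "\<lambda>k. x < b k", OF x])
  have 3: "k \<noteq> 0"
  proof
    assume "k = 0"
    then show False using 1 assms by simp
  qed
  have "\<not> x < b (k - 1)"
    using not_less_Least[of "k - 1" "\<lambda>k. x < b k"] 3 by (simp add: k_def[symmetric])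
  then show thesis using 1 2 3 by (intro that[of k]) simp_all
qed

lemma interval_exists_left_open:
  assumes "0 < x" "x \<le> 1"
  obtains k where "k \<in> {1..r}" "b (k - 1) < x" "x \<le> b k"
proof -
  define k where "k = (LEAST k. x \<le> b k)"
  have x: "x \<le> b r" using assms by simp
  have 1: "x \<le> b k" unfolding k_def by (rule LeastI[of "\<lambda>k. x \<le> b k", OF x])
  have 2: "k \<le> r" unfolding k_def by (rule Least_le[of "\<lambda>k. x \<le> b k", OF x])
  have 3: "k \<noteq> 0"
  proof
    assume "k = 0"
    then show False using 1 assms by simp
  qed
  have "\<not> x \<le> b (k - 1)"
    using not_less_Least[of "k - 1" "\<lambda>k. x \<le> b k"] 3 by (simp add: k_def[symmetric])
  then show thesis using 1 2 3 by (intro that[of k]) simp_all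
qed

lemma idx:
  assumes "x \<in> {0..<1}"
  shows "idx x \<in> {1..r}" "b (idx x - 1) \<le> x" "x < b (idx x)"
proof -
  obtain k where "k \<in> {1..r}" "b (k - 1) \<le> x" "x < b k"
    using interval_exists[OF assms] by blast
  moreover from this have "idx x = k" by (rule idx_eqI)
  ultimately show "idx x \<in> {1..r}" "b (idx x - 1) \<le> x" "x < b (idx x)" by simp_all
qed

lemma inv_perm:
  assumes "j \<in> {1..r}"
  shows "inv \<pi> j = r + 1 - j"
proof (rule inv_f_eq)
  show "inj \<pi>" by (rule permutes_inj[OF perm])
  have "r + 1 - j \<in> {1..r}" using assms by auto
  then show "\<pi> (r + 1 - j) = j" using assms reversal by simp
qed

text \<open>For the reversing permutation the intervals to the right of \<open>I\<^sub>k\<close> are moved to its left, which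
turns the two sums in the definition into \<open>1 - b k\<close> and \<open>b (k - 1)\<close>.\<close>

lemma T_eq:
  assumes "x \<in> {0..<1}"
  shows "T x = x + shift (idx x)"
proof -
  define k where "k = idx x"
  have k: "k \<in> {1..r}" using idx[OF assms] by (simp add: k_def)
  have "(\<Sum>j\<in>{1..<\<pi> k}. \<alpha> (inv \<pi> j)) = (\<Sum>j\<in>{1..<r + 1 - k}. \<alpha> (r + 1 - j))"
    using k reversal[OF k] inv_perm by (intro sum.cong) auto
  also have "\<dots> = (\<Sum>i\<in>{k + 1..r}. \<alpha> i)"
    using k by (intro sum.reindex_bij_witness[of _ "\<lambda>i. r + 1 - i" "\<lambda>i. r + 1 - i"]) auto
  also have "\<dots> = 1 - b k"
  proof -
    have "{1..r} = {1..k} \<union> {k + 1..r}" using k by auto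
    then have "(\<Sum>i=1..r. \<alpha> i) = b k + (\<Sum>i\<in>{k + 1..r}. \<alpha> i)"
      unfolding b_def by (simp add: sum.union_disjoint)
    then show ?thesis using total_length by simp
  qed
  finally have "(\<Sum>j\<in>{1..<\<pi> k}. \<alpha> (inv \<pi> j)) = 1 - b k" .
  moreover have "{1..<k} = {1..k - 1}" using k by auto
  ultimately show ?thesis
    by (simp add: iet_def Let_def k_def[symmetric] shift_def b_def)
qed

lemma T_eq_on_interval:
  assumes "k \<in> {1..r}" "b (k - 1) \<le> x" "x < b k"
  shows "T x = x + shift k"
  using T_eq[OF interval_subset[OF assms]] idx_eqI[OF assms] by simp

lemma T_in: assumes "x \<in> {0..<1}" shows "T x \<in> {0..<1}"
proof -
  note i = idx[OF assms]
  have "idx x \<le> r" "idx x - 1 \<le> r" using i(1) by auto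
  then have "b (idx x) \<le> 1" "0 \<le> b (idx x - 1)" by (simp_all add: b_le_1 b_nonneg)
  then show ?thesis using i(2,3) T_eq[OF assms] by (simp add: shift_def)
qed

lemma T_bij: "bij_betw T {0..<1} {0..<1}"
  unfolding bij_betw_def
proof
  show "inj_on T {0..<1}"
  proof (rule inj_onI)
    have neq: "T x \<noteq> T y" if xy: "x \<in> {0..<1}" "y \<in> {0..<1}" and lt: "idx x < idx y" for x y
    proof -
      have "b (idx x) \<le> b (idx y - 1)" using lt idx(1)[OF xy(2)] by (intro b_mono) auto
      then show ?thesis
        using idx(2)[OF xy(1)] idx(3)[OF xy(2)] T_eq[OF xy(1)] T_eq[OF xy(2)] by (simp add: shift_def)
    qed
    fix x y assume xy: "x \<in> {0..<1}" "y \<in> {0..<1}" "T x = T y"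
    have "\<not> idx x < idx y" using neq[OF xy(1,2)] xy(3) by blast
    moreover have "\<not> idx y < idx x" using neq[OF xy(2,1)] xy(3) by metis
    ultimately have "shift (idx x) = shift (idx y)" by simp
    then show "x = y" using T_eq[OF xy(1)] T_eq[OF xy(2)] xy(3) by linarith
  qed
  show "T ` {0..<1} = {0..<1}"
  proof
    show "T ` {0..<1} \<subseteq> {0..<1}" using T_in by blast
    show "{0..<1} \<subseteq> T ` {0..<1}"
    proof
      fix y :: real assume y: "y \<in> {0..<1}"
      then obtain k where k: "k \<in> {1..r}" "b (k - 1) < 1 - y" "1 - y \<le> b k"
        using interval_exists_left_open[of "1 - y"] by (auto simp del: One_nat_def)
      define x where "x = y - shift k"
      have x: "b (k - 1) \<le> x" "x < b k" using k(2,3) by (simp_all add: x_def shift_def)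
      have "T x = y" using T_eq_on_interval[OF k(1) x] by (simp add: x_def)
      moreover have "x \<in> {0..<1}" by (rule interval_subset[OF k(1) x])
      ultimately show "y \<in> T ` {0..<1}" by blast
    qed
  qed
qed

lemma T_piecewise_translation: "piecewise_translation T breaks"
  unfolding piecewise_translation_def
proof (intro conjI ballI)
  show "bij_betw T {0..<1} {0..<1}" by (rule T_bij)
  show "finite breaks" by simp
  show "breaks \<subseteq> {0..<1}" by (rule breaks_subset)
  fix x :: real assume x: "x \<in> {0..<1}"
  note i = idx[OF x]
  show "\<exists>d\<in>breaks. d \<le> x \<and> (\<forall>y\<in>{d..x}. T y - y = T x - x)"
  proof (intro bexI conjI ballI)
    show "b (idx x - 1) \<in> breaks" using i(1) by auto
    show "b (idx x - 1) \<le> x" by (rule i(2))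
    fix y assume "y \<in> {b (idx x - 1)..x}"
    then show "T y - y = T x - x" using T_eq_on_interval[OF i(1), of y] T_eq[OF x] i(3) by simp
  qed
qed

lemma Tn_bij: "bij_betw (T ^^ n) {0..<1} {0..<1}"
proof (induction n)
  case (Suc n)
  then show ?case using bij_betw_trans[OF Suc T_bij] by (simp only: funpow.simps)
qed (simp add: bij_betw_def)

lemma Tn_in: "x \<in> {0..<1} \<Longrightarrow> (T ^^ n) x \<in> {0..<1}"
  using bij_betwE[OF Tn_bij[of n]] by blast

lemma Tn_inj: "(T ^^ n) x = (T ^^ n) y \<Longrightarrow> x \<in> {0..<1} \<Longrightarrow> y \<in> {0..<1} \<Longrightarrow> x = y"
  using Tn_bij[of n] by (auto simp: bij_betw_def dest: inj_onD)

section \<open>Displacements and rational independence\<close>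

text \<open>The integer combinations of the lengths; rational independence makes the coefficients unique.\<close>

definition comb :: "(nat \<Rightarrow> int) \<Rightarrow> real" where
  "comb c = (\<Sum>i=1..r. of_int (c i) * \<alpha> i)"

lemma comb_add: "comb (\<lambda>i. c i + d i) = comb c + comb d"
  by (simp add: comb_def ring_distribs sum.distrib)

lemma comb_diff: "comb (\<lambda>i. c i - d i) = comb c - comb d"
  by (simp add: comb_def left_diff_distrib sum_subtractf)

lemma comb_0: assumes "comb c = 0" "i \<in> {1..r}" shows "c i = 0"
proof -
  interpret Q: vector_space "\<lambda>(q::rat) (x::real). of_rat q * x"
    by unfold_locales (simp_all add: algebra_simps of_rat_add of_rat_mult)
  (* The coefficients, indexed by the vectors themselves. *)
  define u where "u v = (of_int (c (inv_into {1..r} \<alpha> v)) :: rat)" for v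
  have u: "u (\<alpha> i) = of_int (c i)" if "i \<in> {1..r}" for i
    using that lengths_inj by (simp add: u_def)
  have "(\<Sum>v\<in>\<alpha> ` {1..r}. of_rat (u v) * v) = comb c"
    using lengths_inj u by (simp add: sum.reindex comb_def)
  then have "u v = 0" if "v \<in> \<alpha> ` {1..r}" for v
    using Q.dependent_finite[of "\<alpha> ` {1..r}"] lengths_indep assms(1) that by auto
  then show ?thesis using u[OF assms(2)] assms(2) by auto
qed

lemma comb_unique: "comb c = comb d \<Longrightarrow> i \<in> {1..r} \<Longrightarrow> c i = d i"
  using comb_0[of "\<lambda>i. c i - d i" i] by (simp add: comb_diff)

lemma b_comb: assumes "k \<le> r" shows "b k = comb (\<lambda>i. if i \<le> k then 1 else 0)"
proof -
  have "comb (\<lambda>i. if i \<le> k then 1 else 0) = (\<Sum>i=1..r. if i \<in> {1..k} then \<alpha> i else 0)"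
    unfolding comb_def by (intro sum.cong) auto
  also have "\<dots> = (\<Sum>i\<in>{1..r} \<inter> {1..k}. \<alpha> i)" by (rule sum.inter_restrict[symmetric]) simp
  also have "{1..r} \<inter> {1..k} = {1..k}" using assms by auto
  finally show ?thesis by (simp add: b_def)
qed

text \<open>For \<open>1 \<le> i \<le> r\<close> this is the sign of \<open>i - k\<close>: the map adds the lengths to the right of \<open>I\<^sub>k\<close> and
subtracts those to its left.\<close>

definition shift_coeff :: "nat \<Rightarrow> nat \<Rightarrow> int" where
  "shift_coeff k i = (if i \<le> r then 1 else 0) - (if i \<le> k then 1 else 0) - (if i \<le> k - 1 then 1 else 0)"

lemma shift_comb: "k \<le> r \<Longrightarrow> shift k = comb (shift_coeff k)"
  using b_comb[of r] b_comb[of k] b_comb[of "k - 1"]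
  unfolding shift_coeff_def comb_diff by (simp add: shift_def)

text \<open>The integer \<open>c r - c 1\<close> is a clock: since, for \<open>r \<ge> 2\<close>, every \<open>shift_coeff k\<close> is larger at \<open>r\<close> than at \<open>1\<close>, each application of \<open>T\<close> raises it by at least one. Uniqueness of coefficients lets the clock be
read off from the displacement alone, and this excludes periodic orbits and almost all orbits
between breaks.\<close>

lemma drift:
  assumes "x \<in> {0..<1}"
  shows "\<exists>c. (T ^^ m) x - x = comb c \<and> (r \<ge> 2 \<longrightarrow> c r - c 1 \<ge> int m)"
proof (induction m)
  case 0
  show ?case by (intro exI[of _ "\<lambda>_. 0"]) (simp add: comb_def)
next
  case (Suc m)
  then obtain c where c: "(T ^^ m) x - x = comb c" "r \<ge> 2 \<longrightarrow> c r - c 1 \<ge> int m" by blast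
  define k where "k = idx ((T ^^ m) x)"
  have k: "k \<in> {1..r}" using idx(1)[OF Tn_in[OF assms]] by (simp add: k_def)
  have "(T ^^ Suc m) x = (T ^^ m) x + shift k"
    using T_eq[OF Tn_in[OF assms, of m]] by (simp add: k_def)
  then have "(T ^^ Suc m) x - x = comb (\<lambda>i. c i + shift_coeff k i)"
    using c(1) k by (simp add: comb_add shift_comb)
  moreover have "r \<ge> 2 \<longrightarrow> shift_coeff k r - shift_coeff k 1 \<ge> 1"
    using k by (auto simp: shift_coeff_def)
  ultimately show ?case using c(2) by (intro exI[of _ "\<lambda>i. c i + shift_coeff k i"]) auto
qed

lemma aperiodic:
  assumes "r \<ge> 2" "x \<in> {0..<1}" "(T ^^ m) x = x"
  shows "m = 0"
proof -
  obtain c where c: "comb c = 0" "c r - c 1 \<ge> int m"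
    using drift[OF assms(2), of m] assms(1,3) by auto
  then show ?thesis using comb_0[OF c(1), of r] comb_0[OF c(1), of 1] assms(1) by auto
qed

lemma orbit_inj:
  assumes "r \<ge> 2" "x \<in> {0..<1}" "(T ^^ m) x = (T ^^ n) x"
  shows "m = n"
proof -
  have less: "\<not> m < n" if "(T ^^ m) x = (T ^^ n) x" for m n
  proof
    assume "m < n"
    then have "(T ^^ (n - m)) ((T ^^ m) x) = (T ^^ m) x"
      using that by (metis comp_apply funpow_add le_add_diff_inverse2 less_imp_le)
    then have "n - m = 0" using aperiodic[OF assms(1) Tn_in[OF assms(2)]] by blast
    then show False using \<open>m < n\<close> by simp
  qed
  show ?thesis using less[OF assms(3)] less[OF assms(3)[symmetric]] by simp
qed

text \<open>The clock difference of two breaks \<open>b l\<close> and \<open>b j\<close> is at most one, so one step is all that can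
separate them. The exception occurs: \<open>T\<close> maps the last break to \<open>0\<close>.\<close>

lemma break_to_break:
  assumes "r \<ge> 2" "l < r" "j < r" "(T ^^ m) (b l) = b j"
  shows "m = 0 \<or> m = 1 \<and> j = 0"
proof -
  have "b l \<in> {0..<1}" using breaks_subset assms(2) by blast
  then obtain c where c: "(T ^^ m) (b l) - b l = comb c" "c r - c 1 \<ge> int m"
    using drift assms(1) by blast
  have "comb c = comb (\<lambda>i. (if i \<le> j then 1 else 0) - (if i \<le> l then 1 else 0))"
    unfolding comb_diff using c(1) assms b_comb[of j] b_comb[of l] by simp
  from comb_unique[OF this, of r] comb_unique[OF this, of 1] show ?thesis
    using c(2) assms by (auto split: if_splits)
qed

section \<open>Density of orbits\<close>

text \<open>By aperiodicity and the preceding gap argument, the forward orbit of a left end meets a break, and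
its backward orbit meets the image of a break. This is an orbit segment from break to break, which
is only possible in one step and at \<open>0\<close>; left ends are positive.\<close>

lemma no_left_end:
  assumes r: "r \<ge> 2" and inv: "\<And>x. x \<in> {0..<1} \<Longrightarrow> T x \<in> V \<longleftrightarrow> x \<in> V"
  shows "\<not> left_end V a"
proof
  assume a: "left_end V a"
  then have a01: "a \<in> {0..<1}" "a \<noteq> 0" by (simp_all add: left_end_def)
  let ?G = "inv_into {0..<1} T"
  have G_in: "?G x \<in> {0..<1}" and TG: "T (?G x) = x" if "x \<in> {0..<1}" for x
    using bij_betwE[OF bij_betw_inv_into[OF T_bij]] bij_betw_inv_into_right[OF T_bij] that by blast+
  have Gn: "(?G ^^ n) a \<in> {0..<1} \<and> (T ^^ n) ((?G ^^ n) a) = a" for n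
  proof (induction n)
    case 0
    show ?case using a01 by simp
  next
    case (Suc n)
    have "(T ^^ Suc n) ((?G ^^ Suc n) a) = (T ^^ n) (T ((?G ^^ Suc n) a))"
      by (simp only: funpow_Suc_right comp_apply)
    also have "\<dots> = (T ^^ n) (T (?G ((?G ^^ n) a)))" by simp
    also have "\<dots> = a" using TG Suc by simp
    finally show ?case using G_in Suc by simp
  qed
  have "\<exists>p. (T ^^ p) a \<in> breaks"
  proof (rule ccontr)
    assume "\<nexists>p. (T ^^ p) a \<in> breaks"
    moreover have "inj (\<lambda>n. (T ^^ n) a)" by (rule injI) (rule orbit_inj[OF r a01(1)])
    ultimately show False
      using no_wandering_left_end[OF T_piecewise_translation inv a] by blast
  qed
  then obtain p j where p: "j < r" "(T ^^ p) a = b j" by auto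
  have "\<exists>q. (?G ^^ q) a \<in> T ` breaks"
  proof (rule ccontr)
    assume avoid: "\<nexists>q. (?G ^^ q) a \<in> T ` breaks"
    have "inj (\<lambda>n. (?G ^^ n) a)"
    proof (rule injI)
      fix m n assume "(?G ^^ m) a = (?G ^^ n) a"
      then have "(T ^^ m) ((?G ^^ m) a) = (T ^^ n) ((?G ^^ m) a)" using Gn[of m] Gn[of n] by simp
      then show "m = n" using orbit_inj[OF r] Gn[of m] by blast
    qed
    moreover have "?G x \<in> V \<longleftrightarrow> x \<in> V" if "x \<in> {0..<1}" for x
      using inv[OF G_in[OF that]] TG[OF that] by simp
    ultimately show False
      using no_wandering_left_end[OF piecewise_translation_inv[OF T_piecewise_translation] _ a] avoid
      by blast
  qed
  then obtain q l where q: "l < r" "(?G ^^ q) a = T (b l)" by auto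
  have aq: "a = (T ^^ q) (T (b l))" using Gn[of q] q by simp
  have "(T ^^ (p + Suc q)) (b l) = (T ^^ p) ((T ^^ q) (T (b l)))"
    by (simp only: funpow_add funpow_Suc_right comp_apply)
  also have "\<dots> = b j" using aq p by simp
  finally have "(T ^^ (p + Suc q)) (b l) = b j" .
  then have "p + Suc q = 0 \<or> p + Suc q = 1 \<and> j = 0"
    by (rule break_to_break[OF r q(1) p(1)])
  then have "p = 0" "j = 0" by auto
  then show False using p(2) a01(2) by simp
qed

lemma T_first: "0 \<le> x \<Longrightarrow> x < b 1 \<Longrightarrow> T x = x + (1 - b 1)"
  using T_eq_on_interval[of 1 x] r_pos by (simp add: shift_def)

text \<open>Points of \<open>V\<close> above \<open>1 - b 1 = T 0\<close> come from the first interval, where \<open>T\<close> adds \<open>1 - b 1\<close>. If no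
positive point of \<open>V\<close> were at or below \<open>1 - b 1\<close>, this amount could be subtracted forever.\<close>

lemma invariant_meets_initial:
  assumes r: "r \<ge> 2" and V: "V \<subseteq> {0..<1}" "V \<noteq> {}"
    and inv: "\<And>x. x \<in> {0..<1} \<Longrightarrow> T x \<in> V \<longleftrightarrow> x \<in> V"
  shows "\<exists>v\<in>V. 0 < v \<and> v \<le> 1 - b 1"
proof (rule ccontr)
  assume no: "\<not> (\<exists>v\<in>V. 0 < v \<and> v \<le> 1 - b 1)"
  define s where "s = 1 - b 1"
  have s: "0 < s" using b_strict[of 1 r] r by (simp add: s_def)
  have big: "s < v" if "v \<in> V" "0 < v" for v using no that unfolding s_def by (meson not_le)
  obtain x where x: "x \<in> V" using V by blast
  then have x01: "x \<in> {0..<1}" using V(1) by blast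
  have Tx: "T x \<in> V" using inv[OF x01] x by simp
  have ne: "T x \<noteq> x"
  proof
    assume "T x = x"
    then show False using aperiodic[OF r x01, of 1] by simp
  qed
  (* As 0 is not fixed, x and T x cannot both be 0. *)
  obtain y where y: "y \<in> V" "y > 0"
  proof (cases "x = 0")
    case True
    then show ?thesis using that[OF Tx] ne T_in[OF x01] by simp
  next
    case False
    then show ?thesis using that[OF x] x01 by simp
  qed
  have desc: "y - real n * s \<in> V \<and> y - real n * s > 0" for n
  proof (induction n)
    case (Suc n)
    define z where "z = y - real n * s"
    have "z \<in> V" "0 < z" using Suc by (simp_all add: z_def)
    then have z: "z \<in> V" "s < z" "z < 1" using big[of z] subsetD[OF V(1), of z] by simp_all
    then have "T (z - s) = z" using T_first[of "z - s"] by (simp add: s_def)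
    then have "z - s \<in> V" using inv[of "z - s"] z s by simp
    then show ?case using z by (simp add: z_def algebra_simps)
  qed (use y in simp)
  obtain n where "y < real n * s" using reals_Archimedean3[OF s] by blast
  then show False using desc[of n] by simp
qed

text \<open>A gap with a positive point of \<open>V\<close> to its left produces a left end. A gap starting at \<open>0\<close> has no
such point, but its image starts at \<open>T 0 = 1 - b 1\<close> and has one.\<close>

lemma invariant_dense:
  assumes r: "r \<ge> 2" and V: "V \<subseteq> {0..<1}" "V \<noteq> {}"
    and inv: "\<And>x. x \<in> {0..<1} \<Longrightarrow> T x \<in> V \<longleftrightarrow> x \<in> V"
    and cd: "0 \<le> c" "c < d" "d \<le> 1"
  shows "{c<..<d} \<inter> V \<noteq> {}"
proof
  assume gap: "{c<..<d} \<inter> V = {}"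
  have nole: "\<not> (0 < v \<and> v \<le> c)" if "{c<..<d} \<inter> V = {}" "c < d" "d \<le> 1" "v \<in> V" for c d v
    using left_end_of_gap[OF that] no_left_end[OF r inv] by blast
  define e where "e = min d (b 1)"
  have b1: "0 < b 1" using b_strict[of 0 1] r by simp
  have e: "0 < e" "e \<le> b 1" "b 1 \<le> 1" using cd b1 b_le_1[of 1] r by (auto simp: e_def)
  (* A point of V in this interval would lie to the left of the given gap. *)
  have gap0: "{0<..<0 + e} \<inter> V = {}"
  proof (rule ccontr)
    assume "{0<..<0 + e} \<inter> V \<noteq> {}"
    then obtain v where "v \<in> V" "0 < v" "v < d" by (auto simp: e_def)
    then show False using nole[OF gap cd(2,3), of v] gap by (auto simp: disjoint_iff)
  qed
  have no_break: "{0<..<0 + e} \<inter> breaks = {}"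
  proof (rule ccontr)
    assume "{0<..<0 + e} \<inter> breaks \<noteq> {}"
    then obtain j where "j < r" "b j \<in> {0<..<0 + e}" by blast
    then have j: "j < r" "0 < b j" "b j < b 1" using e by simp_all
    then have "j \<noteq> 0" by (metis b_0 less_irrefl)
    then show False using b_mono[of 1 j] j by simp
  qed
  have "{T 0<..<T 0 + e} \<inter> V = {}"
    using gap_image[OF T_piecewise_translation _ _ inv no_break gap0] e by auto
  moreover have "T 0 = 1 - b 1" using T_first[of 0] b1 by simp
  ultimately have gap1: "{1 - b 1<..<1 - b 1 + e} \<inter> V = {}" by simp
  obtain v where "v \<in> V" "0 < v" "v \<le> 1 - b 1"
    using invariant_meets_initial[OF r V inv] by auto
  then show False using nole[OF gap1, of v] e by auto
qed

section \<open>Codes and reflection\<close>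

text \<open>On each \<open>I\<^sub>k\<close> the map \<open>x \<mapsto> 1 - T x\<close> is the reflection of \<open>I\<^sub>k\<close> in its midpoint. Hence \<open>T\<close> is the
product of two reflections, and \<open>x \<mapsto> 1 - x\<close> conjugates it to its inverse up to endpoints. The left endpoint must
be excluded, because it is reflected to the right endpoint, which is not in \<open>I\<^sub>k\<close>.\<close>

lemma reflect:
  assumes "x \<in> {0..<1}" "x \<notin> breaks"
  shows "1 - T x \<in> {0..<1}" "T (1 - T x) = 1 - x" "idx (1 - T x) = idx x"
proof -
  define k where "k = idx x"
  have k: "k \<in> {1..r}" "b (k - 1) \<le> x" "x < b k" using idx[OF assms(1)] by (simp_all add: k_def)
  have "k - 1 < r" using k(1) by auto
  then have "x \<noteq> b (k - 1)" using assms(2) by blast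
  then have lt: "b (k - 1) < x" using k(2) by simp
  have eq: "1 - T x = b k + b (k - 1) - x"
    using T_eq[OF assms(1)] by (simp add: k_def[symmetric] shift_def)
  then have k': "b (k - 1) \<le> 1 - T x" "1 - T x < b k" using k(3) lt by simp_all
  show "1 - T x \<in> {0..<1}" by (rule interval_subset[OF k(1) k'])
  show "idx (1 - T x) = idx x" using idx_eqI[OF k(1) k'] by (simp add: k_def)
  show "T (1 - T x) = 1 - x"
    using T_eq_on_interval[OF k(1) k'] eq by (simp add: shift_def)
qed

lemma length_code [simp]: "length (code n x) = n"
  by (simp add: code_def)

lemma code_nth [simp]: "j < n \<Longrightarrow> code n x ! j = idx ((T ^^ j) x)"
  by (simp add: code_def)

lemma code_Suc: "code (Suc n) x = code n x @ [idx ((T ^^ n) x)]"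
  by (simp add: code_def)

lemma retrace:
  assumes m: "m \<in> {0..<1}" and avoid: "\<And>i. (T ^^ i) m \<notin> breaks"
  shows "(T ^^ j) (1 - (T ^^ j) m) = 1 - m"
proof (induction j)
  case (Suc j)
  have "(T ^^ Suc j) (1 - (T ^^ Suc j) m) = (T ^^ j) (T (1 - (T ^^ Suc j) m))"
    by (simp only: funpow_Suc_right comp_apply)
  also have "\<dots> = (T ^^ j) (1 - (T ^^ j) m)"
    using reflect(2)[OF Tn_in[OF m] avoid] by simp
  finally show ?case using Suc by simp
qed simp

text \<open>The reflected orbit runs backwards, \<open>1 - T\<^sup>j\<^sup>+\<^sup>1 m = T\<^sup>n\<^sup>-\<^sup>1\<^sup>-\<^sup>j m\<close>, and \<open>1 - T\<^sup>j\<^sup>+\<^sup>1 m\<close> lies in the same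
interval as \<open>T\<^sup>j m\<close>.\<close>

lemma palindrome_code_of_centre:
  assumes m: "m \<in> {0..<1}" "(T ^^ n) m = 1 - m" and avoid: "\<And>i. (T ^^ i) m \<notin> breaks"
  shows "palindrome (code n m)"
proof -
  have "code n m ! (n - 1 - j) = code n m ! j" if j: "j < n" for j
  proof -
    have r: "1 - T ((T ^^ j) m) \<in> {0..<1}" "idx (1 - T ((T ^^ j) m)) = idx ((T ^^ j) m)"
      using reflect(1,3)[OF Tn_in[OF m(1)] avoid] by blast+
    have n: "n = Suc j + (n - 1 - j)" using j by simp
    have "(T ^^ Suc j) ((T ^^ (n - 1 - j)) m) = (T ^^ n) m"
      by (subst (2) n) (simp only: funpow_add comp_apply)
    also have "\<dots> = (T ^^ Suc j) (1 - (T ^^ Suc j) m)" using retrace[OF m(1) avoid, of "Suc j"] m(2) by simp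
    finally have "(T ^^ (n - 1 - j)) m = 1 - T ((T ^^ j) m)"
      using Tn_inj[of "Suc j"] Tn_in[OF m(1)] r(1) by simp
    then show ?thesis using r(2) j by simp
  qed
  then show ?thesis
    unfolding palindrome_def by (intro nth_equalityI) (simp_all add: rev_nth)
qed

lemma displacement: "x \<in> {0..<1} \<Longrightarrow> (T ^^ j) x = x + (\<Sum>i<j. shift (idx ((T ^^ i) x)))"
proof (induction j)
  case (Suc j)
  then show ?case using T_eq[OF Tn_in[OF Suc.prems, of j]] by simp
qed simp

text \<open>The code determines the displacement of the orbit. So points with the same code of length \<open>n\<close>
move in parallel for \<open>n\<close> steps.\<close>

lemma displacement_code:
  assumes "x \<in> {0..<1}" "j \<le> n"
  shows "(T ^^ j) x = x + (\<Sum>i<j. shift (code n x ! i))"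
proof -
  have "(\<Sum>i<j. shift (idx ((T ^^ i) x))) = (\<Sum>i<j. shift (code n x ! i))"
    using assms(2) by (intro sum.cong) simp_all
  then show ?thesis using displacement[OF assms(1), of j] by simp
qed

lemma code_eqI:
  assumes m: "m \<in> {0..<1}" and len: "length w = n"
    and itinerary: "\<And>j. j < n \<Longrightarrow> w ! j \<in> {1..r} \<and>
      b (w ! j - 1) \<le> m + (\<Sum>i<j. shift (w ! i)) \<and> m + (\<Sum>i<j. shift (w ! i)) < b (w ! j)"
  shows "code n m = w"
proof -
  have "idx ((T ^^ j) m) = w ! j" if "j < n" for j
    using that
  proof (induction j rule: less_induct)
    case (less j)
    have "(\<Sum>i<j. shift (idx ((T ^^ i) m))) = (\<Sum>i<j. shift (w ! i))"
      using less by (intro sum.cong) simp_all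
    then have "(T ^^ j) m = m + (\<Sum>i<j. shift (w ! i))" using displacement[OF m, of j] by simp
    then show ?case using itinerary[OF less.prems] by (intro idx_eqI) simp_all
  qed
  then show ?thesis using len by (intro nth_equalityI) simp_all
qed

text \<open>The points with a given code form an interval on which \<open>T\<^sup>n\<close> is a translation, and if the code is a
palindrome then \<open>x \<mapsto> 1 - T\<^sup>n x\<close> reflects this interval. The point \<open>m\<close> between \<open>x\<close> and its mirror
image is the midpoint of the interval. Up to endpoints the mirror image satisfies the same
inequalities as \<open>x\<close>, with strict and weak inequality exchanged, so \<open>m\<close> satisfies all of them
strictly.\<close>

lemma centre_of_palindrome_code:
  assumes x: "x \<in> {0..<1}" and pal: "palindrome (code n x)"
  defines "m \<equiv> (x + (1 - (T ^^ n) x)) / 2"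
  shows "m \<in> {0..<1}" "code n m = code n x" "(T ^^ n) m = 1 - m"
proof -
  define w where "w = code n x"
  define s where "s j = (\<Sum>i<j. shift (w ! i))" for j
  have w_in: "w ! j \<in> {1..r}" if "j < n" for j
    using idx(1)[OF Tn_in[OF x, of j]] that by (simp add: w_def)
  have Tx: "(T ^^ j) x = x + s j" if "j \<le> n" for j
    using displacement_code[OF x that] by (simp add: s_def w_def)
  have m_eq: "m = (1 - s n) / 2" using Tx[of n] by (simp add: m_def)
  have w_rev: "w ! (n - 1 - j) = w ! j" if "j < n" for j
    using palindrome_nth[OF pal] that by (simp add: w_def)
  have s_rev: "s (n - j) = s n - s j" if "j \<le> n" for j
    using palindrome_sum[OF pal, of j shift] that by (simp add: s_def w_def)
  show m: "m \<in> {0..<1}" using x Tn_in[OF x, of n] by (simp add: m_def)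
  have strict: "b (w ! j - 1) < m + s j \<and> m + s j < b (w ! j)" if j: "j < n" for j
  proof -
    have "b (w ! i - 1) \<le> x + s i \<and> x + s i < b (w ! i)" if "i < n" for i
      using idx(2,3)[OF Tn_in[OF x, of i]] Tx[of i] that by (simp add: w_def)
    (* The condition at the mirror position is the condition at j for 1 - T^n x. *)
    from this[of j] this[of "n - 1 - j"]
    have 1: "b (w ! j - 1) \<le> x + s j" "x + s j < b (w ! j)"
      and 2: "b (w ! j - 1) \<le> x + s (n - 1 - j)" "x + s (n - 1 - j) < b (w ! j)"
      using j w_rev[OF j] by simp_all
    have "s (n - 1 - j) = s n - (s j + shift (w ! j))"
      using s_rev[of "Suc j"] j by (simp add: s_def)
    then have "b (w ! j - 1) < 1 - s n - x + s j" "1 - s n - x + s j \<le> b (w ! j)"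
      using 2 by (simp_all add: shift_def)
    then show ?thesis using 1 by (simp add: m_eq field_simps)
  qed
  have "code n m = w"
    using strict w_in by (intro code_eqI[OF m]) (simp_all add: w_def s_def less_imp_le)
  then show "code n m = code n x" by (simp add: w_def)
  have "(T ^^ n) m = m + s n"
    using displacement_code[OF m order_refl, of n] \<open>code n m = w\<close> by (simp add: s_def)
  then show "(T ^^ n) m = 1 - m" by (simp add: m_eq field_simps)
qed

lemma code_right_constant:
  assumes y: "y \<in> {0..<1}"
  shows "\<exists>e>0. \<forall>x\<in>{y..<y + e}. x < 1 \<and> code n x = code n y"
proof (induction n)
  case 0
  show ?case using y by (intro exI[of _ "1 - y"]) (simp add: code_def)
next
  case (Suc n)
  then obtain e where e: "e > 0" "\<And>x. x \<in> {y..<y + e} \<Longrightarrow> x < 1 \<and> code n x = code n y" by blast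
  define k where "k = idx ((T ^^ n) y)"
  have k: "k \<in> {1..r}" "b (k - 1) \<le> (T ^^ n) y" "(T ^^ n) y < b k"
    using idx[OF Tn_in[OF y, of n]] by (simp_all add: k_def)
  define f where "f = min e (b k - (T ^^ n) y)"
  have f: "f \<le> e" "f \<le> b k - (T ^^ n) y" by (simp_all add: f_def)
  have "x < 1 \<and> code (Suc n) x = code (Suc n) y" if x: "x \<in> {y..<y + f}" for x
  proof -
    have c: "x < 1" "code n x = code n y" using e(2)[of x] x f(1) by simp_all
    have x01: "x \<in> {0..<1}" using x y c(1) by simp
    have "(T ^^ n) x = x - y + (T ^^ n) y"
      using displacement_code[OF x01 order_refl, of n] displacement_code[OF y order_refl, of n] c(2)
      by simp
    then have "idx ((T ^^ n) x) = k" using k x f(2) by (intro idx_eqI) simp_all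
    then show ?thesis using c by (simp add: code_Suc k_def)
  qed
  moreover have "f > 0" using e(1) k(3) by (simp add: f_def)
  ultimately show ?case by blast
qed

text \<open>The interval of points with the same code as \<open>y\<close> is met by the dense set \<open>V\<close>. For \<open>r = 1\<close> the map is
the identity and its orbits are single points, but there is only one code of each length.\<close>

lemma code_attained:
  assumes V: "V \<subseteq> {0..<1}" "V \<noteq> {}" and inv: "\<And>x. x \<in> {0..<1} \<Longrightarrow> T x \<in> V \<longleftrightarrow> x \<in> V"
    and y: "y \<in> {0..<1}"
  shows "code n y \<in> code n ` V"
proof (cases "r \<ge> 2")
  case True
  obtain e where e: "e > 0" "\<And>x. x \<in> {y..<y + e} \<Longrightarrow> x < 1 \<and> code n x = code n y"
    using code_right_constant[OF y] by blast
  define d where "d = min (y + e) 1"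
  have "y < d" "d \<le> 1" "0 \<le> y" using e(1) y by (simp_all add: d_def)
  then have "{y<..<d} \<inter> V \<noteq> {}" using invariant_dense[OF True V inv, of y d] by blast
  then obtain v where "v \<in> V" "v \<in> {y<..<d}" by blast
  moreover from this have "code n v = code n y" using e(2)[of v] by (simp add: d_def)
  ultimately show ?thesis by (metis imageI)
next
  case False
  obtain v where v: "v \<in> V" using V(2) by blast
  have const: "code n x = replicate n 1" if "x \<in> {0..<1}" for x
  proof (rule nth_equalityI)
    fix j assume j: "j < length (code n x)"
    have "idx ((T ^^ j) x) = 1" using idx(1)[OF Tn_in[OF that, of j]] False by simp
    then show "code n x ! j = replicate n 1 ! j" using j by simp
  qed simp
  have "code n y = code n v"
    by (rule trans[OF const[OF y] const[OF subsetD[OF V(1) v], symmetric]])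
  then show ?thesis using v by (rule image_eqI)
qed

section \<open>Centres of palindromes\<close>

definition lattice :: "real set" where "lattice = range comb"

lemma lattice_add: "x \<in> lattice \<Longrightarrow> y \<in> lattice \<Longrightarrow> x + y \<in> lattice"
  unfolding lattice_def by (auto simp: comb_add[symmetric])

lemma lattice_diff: "x \<in> lattice \<Longrightarrow> y \<in> lattice \<Longrightarrow> x - y \<in> lattice"
  unfolding lattice_def by (auto simp: comb_diff[symmetric])

lemma Tn_lattice_iff:
  assumes "x \<in> {0..<1}"
  shows "(T ^^ n) x \<in> lattice \<longleftrightarrow> x \<in> lattice"
proof -
  have "(T ^^ n) x - x \<in> lattice" using drift[OF assms, of n] by (auto simp: lattice_def)
  then show ?thesis
    using lattice_add[of "(T ^^ n) x - x" x] lattice_diff[of "(T ^^ n) x" "(T ^^ n) x - x"] by auto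
qed

text \<open>Odd coefficients cannot be halved. This keeps the orbits of \<open>1/2\<close> and of the midpoints apart from
those of the breaks, which are integer combinations.\<close>

lemma not_lattice_if_odd_double:
  assumes "2 * x = comb c" "i \<in> {1..r}" "odd (c i)"
  shows "x \<notin> lattice"
proof
  assume "x \<in> lattice"
  then obtain d where "x = comb d" by (auto simp: lattice_def)
  then have "comb c = comb d + comb d" using assms(1) by simp
  then have "comb c = comb (\<lambda>i. d i + d i)" by (simp only: comb_add)
  then have "c i = d i + d i" using assms(2) by (rule comb_unique)
  then show False using assms(3) by simp
qed

definition centre_values :: "nat \<Rightarrow> real set" where
  "centre_values n = (if even n then {1 / 2} else midpoint ` {1..r})"

lemma midpoint_in_interval: "k \<in> {1..r} \<Longrightarrow> b (k - 1) < midpoint k \<and> midpoint k < b k"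
  using b_strict[of "k - 1" k] by (simp add: midpoint_def)

lemma idx_midpoint: "k \<in> {1..r} \<Longrightarrow> idx (midpoint k) = k"
  using midpoint_in_interval[of k] by (intro idx_eqI) simp_all

lemma centre_values_subset: "centre_values n \<subseteq> {0..<1}"
proof -
  have "midpoint k \<in> {0..<1}" if "k \<in> {1..r}" for k
    using midpoint_in_interval[OF that] interval_subset[OF that, of "midpoint k"] by simp
  then show ?thesis by (auto simp: centre_values_def)
qed

lemma card_centre_values: "card (centre_values n) = (if even n then 1 else r)"
proof -
  have "inj_on midpoint {1..r}" by (rule inj_on_inverseI[of _ idx]) (rule idx_midpoint)
  then show ?thesis by (simp add: centre_values_def card_image)
qed

lemma centre_values_not_lattice:
  assumes "v \<in> centre_values n"
  shows "v \<notin> lattice"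
proof (cases "even n")
  case True
  (* Here 2 v = 1 is the sum of all lengths, so every coefficient is odd. *)
  then have "2 * v = comb (\<lambda>i. if i \<le> r then 1 else 0)"
    using assms b_comb[of r] by (simp add: centre_values_def)
  then show ?thesis using not_lattice_if_odd_double[of v _ 1] r_pos by auto
next
  case False
  then obtain k where k: "k \<in> {1..r}" "v = midpoint k" using assms by (auto simp: centre_values_def)
  (* Here 2 v = b (k - 1) + b k, where the length k occurs exactly once. *)
  have "k \<le> r" "k - 1 \<le> r" using k(1) by auto
  then have "2 * v = comb (\<lambda>i. (if i \<le> k - 1 then 1 else 0) + (if i \<le> k then 1 else 0))"
    unfolding comb_add using k(2) b_comb[of k] b_comb[of "k - 1"] by (simp add: midpoint_def)
  then show ?thesis using k(1) by (rule not_lattice_if_odd_double) (use k(1) in auto)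
qed

text \<open>The iterate \<open>n div 2\<close> sits in the middle of the orbit segment coded by a word of length \<open>n\<close>: between
the two central letters for even \<open>n\<close>, at the central letter for odd \<open>n\<close>.\<close>

definition centres :: "nat \<Rightarrow> real set" where
  "centres n = {m \<in> {0..<1}. (T ^^ (n div 2)) m \<in> centre_values n}"

lemma card_centres: "card (centres n) = (if even n then 1 else r)"
proof -
  let ?F = "T ^^ (n div 2)"
  have "inj_on ?F (centres n)"
    using Tn_inj by (auto simp: centres_def inj_on_def)
  moreover have "?F ` centres n = centre_values n"
  proof
    show "centre_values n \<subseteq> ?F ` centres n"
    proof
      fix v assume v: "v \<in> centre_values n"
      then have "v \<in> ?F ` {0..<1}"
        using centre_values_subset bij_betw_imp_surj_on[OF Tn_bij[of "n div 2"]] by blast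
      then show "v \<in> ?F ` centres n" using v by (auto simp: centres_def)
    qed
  qed (auto simp: centres_def)
  ultimately show ?thesis using card_centre_values by (metis card_image)
qed

lemma centre_avoids_breaks:
  assumes "m \<in> centres n"
  shows "(T ^^ i) m \<notin> breaks"
proof
  assume "(T ^^ i) m \<in> breaks"
  then have "(T ^^ i) m \<in> lattice" using b_comb by (force simp: lattice_def)
  then show False
    using assms centre_values_not_lattice Tn_lattice_iff by (auto simp: centres_def)
qed

text \<open>The two halves of the segment retrace each other: for even \<open>n\<close> because \<open>1/2\<close> is its own mirror image,
for odd \<open>n\<close> because \<open>T\<close> maps each midpoint to its mirror image.\<close>

lemma centre_reflected:
  assumes "m \<in> centres n"
  shows "(T ^^ n) m = 1 - m"
proof -
  have m: "m \<in> {0..<1}" and v: "(T ^^ (n div 2)) m \<in> centre_values n"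
    using assms by (simp_all add: centres_def)
  define k where "k = n div 2"
  have retrace: "(T ^^ j) (1 - (T ^^ j) m) = 1 - m" for j
    using retrace[OF m centre_avoids_breaks[OF assms]] .
  show ?thesis
  proof (cases "even n")
    case True
    then have "n = k + k" unfolding k_def by presburger
    then have "(T ^^ n) m = (T ^^ k) ((T ^^ k) m)" by (simp add: funpow_add)
    moreover have "(T ^^ k) m = 1 - (T ^^ k) m"
      using v True by (simp add: centre_values_def k_def)
    ultimately show ?thesis using retrace[of k] by metis
  next
    case False
    then have "n = k + Suc k" unfolding k_def by presburger
    then have "(T ^^ n) m = (T ^^ k) ((T ^^ Suc k) m)" by (simp only: funpow_add comp_apply)
    moreover have "(T ^^ Suc k) m = 1 - (T ^^ k) m"
    proof -
      obtain i where i: "i \<in> {1..r}" "(T ^^ k) m = midpoint i"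
        using v False by (auto simp: centre_values_def k_def)
      have "T (midpoint i) = midpoint i + shift i"
        using T_eq_on_interval[OF i(1), of "midpoint i"] midpoint_in_interval[OF i(1)] by simp
      also have "\<dots> = 1 - midpoint i" by (simp add: shift_def midpoint_def field_simps)
      finally show ?thesis using i(2) by simp
    qed
    ultimately show ?thesis using retrace[of k] by metis
  qed
qed

text \<open>In a palindromic itinerary both halves contribute the same displacement. Hence the middle of the
segment lies halfway between \<open>m\<close> and \<open>1 - m\<close>, up to the shift of the central letter for odd \<open>n\<close>.\<close>

lemma centreI:
  assumes m: "m \<in> {0..<1}" "(T ^^ n) m = 1 - m" and pal: "palindrome (code n m)"
  shows "m \<in> centres n"
proof -
  define w where "w = code n m"
  define s where "s j = (\<Sum>i<j. shift (w ! i))" for j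
  define k where "k = n div 2"
  have Tm: "(T ^^ j) m = m + s j" if "j \<le> n" for j
    using displacement_code[OF m(1) that] by (simp add: s_def w_def)
  have s_rev: "s (n - k) = s n - s k"
    using palindrome_sum[OF pal, of k shift] by (simp add: s_def w_def k_def)
  have sn: "m + s n = 1 - m" using Tm[of n] m(2) by simp
  have Tk: "(T ^^ k) m = m + s k" using Tm[of k] by (simp add: k_def)
  show ?thesis
  proof (cases "even n")
    case True
    then have "n - k = k" unfolding k_def by presburger
    then have "(T ^^ k) m = 1 / 2" using s_rev sn Tk by simp
    then show ?thesis using m(1) True by (simp add: centres_def centre_values_def k_def)
  next
    case False
    then have "n - k = Suc k" "k < n" unfolding k_def by presburger+
    then have "s k + shift (w ! k) = s n - s k" using s_rev by (simp add: s_def)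
    moreover have "w ! k = idx ((T ^^ k) m)" using \<open>k < n\<close> by (simp add: w_def)
    ultimately have "(T ^^ k) m = midpoint (idx ((T ^^ k) m))"
      using sn Tk by (simp add: shift_def midpoint_def field_simps)
    then have "(T ^^ k) m \<in> midpoint ` {1..r}" using idx(1)[OF Tn_in[OF m(1), of k]] by blast
    then show ?thesis using m(1) False by (simp add: centres_def centre_values_def k_def)
  qed
qed

text \<open>A centre is recovered from its code because the displacement \<open>1 - 2 m\<close> is.\<close>

lemma palindromes_bij_centres:
  assumes V: "V \<subseteq> {0..<1}" "V \<noteq> {}" and inv: "\<And>x. x \<in> {0..<1} \<Longrightarrow> T x \<in> V \<longleftrightarrow> x \<in> V"
  shows "bij_betw (code n) (centres n) {w \<in> code n ` V. palindrome w}"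
  unfolding bij_betw_def
proof
  have centre: "m \<in> {0..<1}" if "m \<in> centres n" for m using that by (simp add: centres_def)
  show "inj_on (code n) (centres n)"
  proof (rule inj_onI)
    fix x y assume xy: "x \<in> centres n" "y \<in> centres n" "code n x = code n y"
    then show "x = y"
      using displacement_code[OF centre[OF xy(1)] order_refl, of n]
        displacement_code[OF centre[OF xy(2)] order_refl, of n]
        centre_reflected[OF xy(1)] centre_reflected[OF xy(2)] by simp
  qed
  show "code n ` centres n = {w \<in> code n ` V. palindrome w}"
  proof (intro equalityI subsetI)
    fix w assume "w \<in> code n ` centres n"
    then obtain m where m: "m \<in> centres n" "w = code n m" by blast
    have "palindrome (code n m)"
      by (rule palindrome_code_of_centre[OF centre[OF m(1)] centre_reflected[OF m(1)]
            centre_avoids_breaks[OF m(1)]])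
    moreover have "code n m \<in> code n ` V" by (rule code_attained[OF V inv centre[OF m(1)]])
    ultimately show "w \<in> {w \<in> code n ` V. palindrome w}" using m(2) by simp
  next
    fix w assume "w \<in> {w \<in> code n ` V. palindrome w}"
    then obtain x where x: "x \<in> V" "w = code n x" and pal: "palindrome (code n x)" by blast
    have x01: "x \<in> {0..<1}" using x(1) V(1) by blast
    note m = centre_of_palindrome_code[OF x01 pal]
    show "w \<in> code n ` centres n"
      using centreI[OF m(1,3)] m(2) pal x(2) by (metis imageI)
  qed
qed

lemma factors_iet_word:
  assumes "x0 \<in> {0..<1}"
  shows "factors (iet_word r \<alpha> \<pi> x0) n = code n ` range (\<lambda>i. int_iterate {0..<1} T i x0)"
proof -
  have "map (\<lambda>j. iet_word r \<alpha> \<pi> x0 (i + int j)) [0..<n] = code n (int_iterate {0..<1} T i x0)" for i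
    by (simp add: iet_word_def code_def int_iterate_add[OF T_bij assms])
  then show ?thesis unfolding factors_def by auto
qed

end

section \<open>The palindromic complexity\<close>

theorem theorem4p1:
  fixes r :: nat and \<alpha> :: "nat \<Rightarrow> real" and \<pi> :: "nat \<Rightarrow> nat" and x0 :: real and n :: nat
  assumes "\<And>i. i \<in> {1..r} \<Longrightarrow> \<alpha> i > 0"
    and "(\<Sum>i=1..r. \<alpha> i) = 1"
    and "inj_on \<alpha> {1..r}"
    and "module.independent (\<lambda>(q::rat) (x::real). of_rat q * x) (\<alpha> ` {1..r})"
    and "\<pi> permutes {1..r}"
    and "\<And>k. k \<in> {1..r} \<Longrightarrow> \<pi> k = r + 1 - k"
    and "x0 \<in> {0..<1}"
  shows "palindromic_complexity (iet_word r \<alpha> \<pi> x0) n = (if even n then 1 else r)"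
proof -
  interpret symmetric_iet r \<alpha> \<pi>
    using assms(1-6) by (rule symmetric_iet.intro)
  let ?V = "range (\<lambda>i. int_iterate {0..<1} T i x0)"
  have "?V \<subseteq> {0..<1}" using int_iterate_in[OF T_bij assms(7)] by blast
  moreover have "T x \<in> ?V \<longleftrightarrow> x \<in> ?V" if "x \<in> {0..<1}" for x
    by (rule orbit_invariant[OF T_bij assms(7) that])
  ultimately have "bij_betw (code n) (centres n) {w \<in> code n ` ?V. palindrome w}"
    by (intro palindromes_bij_centres) auto
  then show ?thesis
    unfolding palindromic_complexity_def factors_iet_word[OF assms(7)]
    using bij_betw_same_card card_centres by metis
qed

end
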